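(* Let $A\in\mathbb{R}^{n\times n}$ be symmetric and let $m\ge1$ be an integer. (a) For $P\in\mathbb{R}^{n\times k}$, $$\mathrm{tr}\Big(P^{\mathrm T}\frac{\partial\,\mathrm{tr}((P^{\mathrm T}AP)^m)}{\partial P}\Big)=2m\,\mathrm{tr}((P^{\mathrm T}AP)^m).$$ (b) For $P,\widehat P\in\mathbb{R}^{n\times k}$, if $A\succeq0$, then $$\mathrm{tr}\Big(\widehat P^{\mathrm T}\frac{\partial\,\mathrm{tr}((P^{\mathrm T}AP)^m)}{\partial P}\Big)\le\mathrm{tr}((\widehat P^{\mathrm T}A\widehat P)^m)+(2m-1)\,\mathrm{tr}((P^{\mathrm T}AP)^m).$$ In particular, if $A\succeq 0$, then $f(P)=\mathrm{tr}((P^{\mathrm T}AP)^m)$ satisfies conditions (1) and (2) of the definition of an atomic function for NPDo with $\mathbb{P}=\mathrm{St}(k,n)$, $Q=I_k$ and $\widetilde P=\widehat P$, $\alpha=1$ and $\beta=2m-1$, and thus is an atomic function for NPDo.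
   Context: $1\le k\le n$; $\mathrm{St}(k,n)=\{P\in\mathbb{R}^{n\times k}: P^{\mathrm T}P=I_k\}$; $A\succeq0$ means symmetric positive semidefinite; $\partial f(P)/\partial P$ is the $n\times k$ matrix of partial derivatives with all entries of $P$ treated as independent. Atomic function for NPDo: a differentiable real function $f$ on a neighborhood $\{P\in\mathbb{R}^{n\times k}:\|P^{\mathrm T}P-I_k\|<\delta\}$ of $\mathrm{St}(k,n)$ for which there are a subset $\mathbb{P}\subseteq\mathrm{St}(k,n)$ and constants $\alpha>0$, $\beta\ge 0$, $\gamma=\alpha+\beta$ such that (1) $\mathrm{tr}\big(P^{\mathrm T}\frac{\partial f(P)}{\partial P}\big)=\gamma f(P)$ for all $P\in\mathbb{P}$; and (2) given $P\in\mathbb{P}$ and $\widehat P\in\mathrm{St}(k,n)$, there exists $Q\in\mathrm{St}(k,k)$ such that $\widetilde P=\widehat PQ\in\mathbb{P}$ and $\mathrm{tr}\big(\widehat P^{\mathrm T}\frac{\partial f(P)}{\partial P}\big)\le\alpha f(\widetilde P)+\beta f(P)$. *)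

theory Defs
  imports "HOL-Analysis.Analysis"
begin

text \<open>An \<open>n \<times> k\<close> real matrix is an element of \<open>real^'k^'n\<close>, so \<open>n = CARD('n)\<close> and
  \<open>k = CARD('k)\<close>; both are at least 1 because types are nonempty.\<close>

definition stiefel :: "(real^'k^'n) set" where
  "stiefel = {P. transpose P ** P = mat 1}"

definition symmetric_matrix :: "real^'n^'n \<Rightarrow> bool" where
  "symmetric_matrix A \<longleftrightarrow> transpose A = A"

definition pos_semidef :: "real^'n^'n \<Rightarrow> bool" where
  "pos_semidef A \<longleftrightarrow> symmetric_matrix A \<and> (\<forall>x. 0 \<le> x \<bullet> (A *v x))"

text \<open>The library operator \<open>^\<close> on \<open>real^'n^'n\<close> is the entrywise power, since \<open>*\<close> is the
  entrywise product there; the power with respect to \<open>**\<close> has to be defined.\<close>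

primrec matrix_power :: "real^'n^'n \<Rightarrow> nat \<Rightarrow> real^'n^'n" where
  "matrix_power A 0 = mat 1"
| "matrix_power A (Suc m) = A ** matrix_power A m"

definition update_entry :: "real^'k^'n \<Rightarrow> 'n \<Rightarrow> 'k \<Rightarrow> real \<Rightarrow> real^'k^'n" where
  "update_entry P i j t = (\<chi> a b. if a = i \<and> b = j then t else P $ a $ b)"

text \<open>Entry \<open>(i, j)\<close> is the partial derivative of \<open>f\<close> at \<open>P\<close> with respect to the \<open>(i, j)\<close> entry,
  all the other entries being held fixed.\<close>

definition matrix_gradient :: "(real^'k^'n \<Rightarrow> real) \<Rightarrow> real^'k^'n \<Rightarrow> real^'k^'n" where
  "matrix_gradient f P = (\<chi> i j. deriv (\<lambda>t. f (update_entry P i j t)) (P $ i $ j))"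

text \<open>The norm below is the Frobenius norm. As all norms on \<open>real^'k^'k\<close> are equivalent and the
  radius \<open>\<delta>\<close> is only required to exist, the choice is immaterial.\<close>

definition stiefel_nbhd :: "real \<Rightarrow> (real^'k^'n) set" where
  "stiefel_nbhd \<delta> = {P. norm (transpose P ** P - mat 1) < \<delta>}"

definition npdo_cond1 :: "(real^'k^'n \<Rightarrow> real) \<Rightarrow> (real^'k^'n) set \<Rightarrow> real \<Rightarrow> bool" where
  "npdo_cond1 f PP \<gamma> \<longleftrightarrow> (\<forall>P\<in>PP. trace (transpose P ** matrix_gradient f P) = \<gamma> * f P)"

text \<open>\<open>Q\<close> is a matrix as required in the second condition for the given \<open>P\<close> and \<open>Ph\<close>, where
  \<open>Ph\<close> stands for \<open>P\<close> with a hat and \<open>Ph ** Q\<close> for \<open>P\<close> with a tilde.\<close>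

definition npdo_witness ::
  "(real^'k^'n \<Rightarrow> real) \<Rightarrow> (real^'k^'n) set \<Rightarrow> real \<Rightarrow> real \<Rightarrow>
    real^'k^'n \<Rightarrow> real^'k^'n \<Rightarrow> real^'k^'k \<Rightarrow> bool" where
  "npdo_witness f PP \<alpha> \<beta> P Ph Q \<longleftrightarrow>
     Q \<in> stiefel \<and> Ph ** Q \<in> PP \<and>
     trace (transpose Ph ** matrix_gradient f P) \<le> \<alpha> * f (Ph ** Q) + \<beta> * f P"

definition npdo_cond2 ::
  "(real^'k^'n \<Rightarrow> real) \<Rightarrow> (real^'k^'n) set \<Rightarrow> real \<Rightarrow> real \<Rightarrow> bool" where
  "npdo_cond2 f PP \<alpha> \<beta> \<longleftrightarrow> (\<forall>P\<in>PP. \<forall>Ph\<in>stiefel. \<exists>Q. npdo_witness f PP \<alpha> \<beta> P Ph Q)"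

text \<open>Only the values of the total function \<open>f\<close> on the open neighbourhood matter.\<close>

definition npdo_atomic :: "(real^'k^'n \<Rightarrow> real) \<Rightarrow> bool" where
  "npdo_atomic f \<longleftrightarrow>
     (\<exists>\<delta>>0. f differentiable_on stiefel_nbhd \<delta>) \<and>
     (\<exists>PP \<alpha> \<beta>. PP \<subseteq> stiefel \<and> \<alpha> > 0 \<and> \<beta> \<ge> 0 \<and>
        npdo_cond1 f PP (\<alpha> + \<beta>) \<and> npdo_cond2 f PP \<alpha> \<beta>)"

definition trace_power :: "real^'n^'n \<Rightarrow> nat \<Rightarrow> real^'k^'n \<Rightarrow> real" where
  "trace_power A m P = trace (matrix_power (transpose P ** A ** P) m)"

end

theory Submission
  imports Defs
begin

text \<open>Write \<open>M\<close>, \<open>N\<close> for the congruences of \<open>A\<close> by \<open>P\<close> and \<open>H\<close>. The gradient paired with \<open>H\<close>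
  is the directional derivative \<open>m * trace (S ** M\<^sup>m\<^sup>-\<^sup>1)\<close>, where the polarized form \<open>S\<close> equals
  \<open>M + N\<close> minus the congruence of \<open>A\<close> by \<open>H - P\<close>. Setting \<open>H = P\<close> gives (a). For (b), the
  subtracted term pairs nonnegatively with \<open>M\<^sup>m\<^sup>-\<^sup>1\<close>, and the rest is the gradient inequality
  \<open>trace N\<^sup>m \<ge> trace M\<^sup>m + m * trace ((N - M) ** M\<^sup>m\<^sup>-\<^sup>1)\<close>. The latter telescopes: with \<open>D = N - M\<close>
  its remainder is a sum of terms \<open>trace (D ** M\<^sup>i ** D ** N\<^sup>j)\<close>, each the trace of a product of
  two positive semidefinite matrices.\<close>

section \<open>Algebra and bounded linearity of the matrix operations\<close>

lemma matrix_diff_ldistrib: "A ** (B - C) = A ** B - A ** (C :: real^'p^'n)"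
  for A :: "real^'n^'m"
  by (simp add: matrix_matrix_mult_def vec_eq_iff right_diff_distrib sum_subtractf)

lemma matrix_diff_rdistrib: "(B - C) ** A = B ** A - C ** (A :: real^'p^'n)"
  for B C :: "real^'n^'m"
  by (simp add: matrix_matrix_mult_def vec_eq_iff left_diff_distrib sum_subtractf)

lemma matrix_add_rdistrib: "(B + C) ** A = B ** A + C ** (A :: real^'p^'n)"
  for B C :: "real^'n^'m"
  by (simp add: matrix_matrix_mult_def vec_eq_iff distrib_right sum.distrib)

lemma transpose_diff: "transpose (A - B) = transpose A - transpose (B :: real^'n^'m)"
  by (simp add: transpose_def vec_eq_iff)

text \<open>Supplies the product rule for derivatives of matrix products.\<close>

lemma bounded_bilinear_matrix_mult:
  "bounded_bilinear ((**) :: real^'n^'m \<Rightarrow> real^'p^'n \<Rightarrow> real^'p^'m)"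
  unfolding bilinear_conv_bounded_bilinear [symmetric] bilinear_def
  by (auto intro!: linearI simp: matrix_add_ldistrib matrix_add_rdistrib
      matrix_matrix_mult_def vec_eq_iff sum_distrib_left algebra_simps sum.distrib)

lemma bounded_linear_transpose:
  "bounded_linear (transpose :: real^'n^'m \<Rightarrow> real^'m^'n)"
  by (rule linear_conv_bounded_linear [THEN iffD1], rule linearI)
    (simp_all add: transpose_def vec_eq_iff)

lemma bounded_linear_trace: "bounded_linear (trace :: real^'n^'n \<Rightarrow> real)"
  by (rule linear_conv_bounded_linear [THEN iffD1], rule linearI)
    (simp_all add: trace_def sum.distrib sum_distrib_left)

lemma trace_matrix_mult: "trace (A ** B) = (\<Sum>i\<in>UNIV. \<Sum>j\<in>UNIV. A $ i $ j * B $ j $ i)"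
  by (simp add: trace_def matrix_matrix_mult_def)

lemma trace_transpose_mult:
  fixes A B :: "real^'k^'n"
  shows "trace (transpose A ** B) = (\<Sum>i\<in>UNIV. \<Sum>j\<in>UNIV. A $ i $ j * B $ i $ j)"
  by (subst sum.swap) (simp add: trace_matrix_mult transpose_def)

section \<open>Matrix powers and positive semidefinite congruences\<close>

lemma matrix_power_add: "matrix_power A (i + j) = matrix_power A i ** matrix_power A j"
  by (induction i) (simp_all add: matrix_mul_assoc)

lemma matrix_power_Suc_right: "matrix_power A (Suc m) = matrix_power A m ** A"
  using matrix_power_add [of A m 1] by simp

lemma pos_semidef_symmetric: "pos_semidef A \<Longrightarrow> transpose A = A"
  by (simp add: pos_semidef_def symmetric_matrix_def)

lemma pos_semidef_congruence:
  fixes A :: "real^'n^'n" and P :: "real^'k^'n"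
  assumes "pos_semidef A"
  shows "pos_semidef (transpose P ** A ** P)"
proof -
  have "x \<bullet> ((transpose P ** A ** P) *v x) = (P *v x) \<bullet> (A *v (P *v x))" for x
  proof -
    have "x \<bullet> ((transpose P ** A ** P) *v x) = x \<bullet> (transpose P *v (A *v (P *v x)))"
      by (simp only: matrix_vector_mul_assoc matrix_mul_assoc)
    also have "\<dots> = (P *v x) \<bullet> (A *v (P *v x))"
      by (metis dot_lmul_matrix vector_transpose_matrix)
    finally show ?thesis .
  qed
  then show ?thesis
    using assms
    by (simp add: pos_semidef_def symmetric_matrix_def matrix_transpose_mul matrix_mul_assoc)
qed

text \<open>Induction in steps of two: \<open>A\<close> is symmetric, so its power
  \<open>l + 2\<close> is the congruence of its power \<open>l\<close> by \<open>A\<close>.\<close>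

lemma pos_semidef_matrix_power:
  assumes "pos_semidef A"
  shows "pos_semidef (matrix_power A m)"
proof (induction m rule: less_induct)
  case (less m)
  consider "m = 0" | "m = 1" | l where "m = Suc (Suc l)"
    by (metis One_nat_def not0_implies_Suc)
  then show ?case
  proof cases
    case 1
    then show ?thesis
      by (simp add: pos_semidef_def symmetric_matrix_def)
  next
    case 2
    then show ?thesis
      using assms by simp
  next
    case 3
    then have "matrix_power A m = transpose A ** matrix_power A l ** A"
      using pos_semidef_symmetric [OF assms] matrix_power_Suc_right [of A "Suc l"] by simp
    moreover have "pos_semidef (matrix_power A l)"
      using less 3 by simp
    ultimately show ?thesis
      by (metis pos_semidef_congruence)
  qed
qed

section \<open>Traces of products of positive semidefinite matrices\<close>

text \<open>Symmetry merges the two cross terms. That this polynomial in \<open>t\<close> is never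
  negative drives \<open>pos_semidef_quadratic_zero\<close> and
  \<open>pos_semidef_eliminate\<close>.\<close>

lemma pos_semidef_shift:
  fixes A :: "real^'n^'n"
  assumes "pos_semidef A"
  shows "(x + t *\<^sub>R y) \<bullet> (A *v (x + t *\<^sub>R y))
    = x \<bullet> (A *v x) + 2 * t * ((A *v y) \<bullet> x) + t\<^sup>2 * (y \<bullet> (A *v y))"
proof -
  have "y \<bullet> (A *v x) = (A *v y) \<bullet> x"
    by (metis assms dot_lmul_matrix pos_semidef_symmetric transpose_matrix_vector)
  then show ?thesis
    by (simp add: matrix_vector_right_distrib matrix_vector_mult_scaleR inner_add_left
        inner_add_right inner_commute [of x "A *v y"] power2_eq_square algebra_simps)
qed

text \<open>On the line from \<open>A *v y\<close> in direction \<open>y\<close> the form is affine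
  in \<open>t\<close>, with slope twice the squared norm of \<open>A *v y\<close>; nonnegativity
  forces the slope to vanish.\<close>

lemma pos_semidef_quadratic_zero:
  assumes "pos_semidef A" and y: "y \<bullet> (A *v y) = 0"
  shows "A *v y = 0"
proof (rule ccontr)
  define v where "v = A *v y"
  define c where "c = v \<bullet> (A *v v)"
  assume "A *v y \<noteq> 0"
  then have v: "v \<bullet> v > 0"
    by (simp add: v_def)
  \<comment> \<open>Solves \<open>c + 2 * t * (v \<bullet> v) = -1\<close>.\<close>
  define t where "t = - (c + 1) / (2 * (v \<bullet> v))"
  have "0 \<le> (v + t *\<^sub>R y) \<bullet> (A *v (v + t *\<^sub>R y))"
    using assms(1) by (simp add: pos_semidef_def)
  also have "\<dots> = c + 2 * t * (v \<bullet> v)"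
    unfolding pos_semidef_shift [OF assms(1)] y by (simp add: c_def flip: v_def)
  also have "\<dots> = -1"
    using v by (simp add: t_def field_simps)
  finally show False
    by simp
qed

definition outer_square :: "real^'n \<Rightarrow> real^'n^'n" where
  "outer_square v = (\<chi> i j. v $ i * v $ j)"

lemma outer_square_mult_vec: "outer_square v *v x = (v \<bullet> x) *\<^sub>R v"
  by (simp add: outer_square_def vec_eq_iff matrix_vector_mult_def inner_vec_def
      sum_distrib_left mult_ac)

lemma trace_mult_outer_square: "trace (X ** outer_square v) = v \<bullet> (X *v v)"
  by (simp add: outer_square_def trace_matrix_mult matrix_vector_mult_def inner_vec_def
      sum_distrib_left mult_ac)

text \<open>The reduced form at \<open>x\<close> is the minimum over \<open>t\<close> of the form of
  \<open>A\<close> at \<open>x + t *\<^sub>R y\<close>.\<close>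

lemma pos_semidef_eliminate:
  fixes A :: "real^'n^'n"
  assumes A: "pos_semidef A" and a: "y \<bullet> (A *v y) > 0"
  shows "pos_semidef (A - (1 / (y \<bullet> (A *v y))) *\<^sub>R outer_square (A *v y))"
    (is "pos_semidef (A - ?c *\<^sub>R outer_square ?v)")
proof -
  have sym: "symmetric_matrix (A - ?c *\<^sub>R outer_square ?v)"
    using pos_semidef_symmetric [OF A]
    by (simp add: symmetric_matrix_def transpose_def vec_eq_iff outer_square_def mult_ac)
  have "0 \<le> x \<bullet> ((A - ?c *\<^sub>R outer_square ?v) *v x)" for x
  proof -
    \<comment> \<open>The minimizer of the polynomial in \<open>pos_semidef_shift\<close>.\<close>
    define t where "t = - ?c * (?v \<bullet> x)"
    have "0 \<le> (x + t *\<^sub>R y) \<bullet> (A *v (x + t *\<^sub>R y))"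
      using A by (simp add: pos_semidef_def)
    also have "\<dots> = x \<bullet> (A *v x) - ?c * (?v \<bullet> x)\<^sup>2"
      unfolding pos_semidef_shift [OF A] t_def
      using a by (simp add: field_simps power2_eq_square)
    also have "\<dots> = x \<bullet> ((A - ?c *\<^sub>R outer_square ?v) *v x)"
      by (simp add: matrix_vector_mult_diff_rdistrib outer_square_mult_vec inner_diff_right
          inner_commute [of x ?v] power2_eq_square flip: scaleR_matrix_vector_assoc)
    finally show ?thesis .
  qed
  with sym show ?thesis
    by (simp add: pos_semidef_def)
qed

text \<open>Cholesky elimination: one pivot at a time splits a rank-one term off \<open>B\<close>. This
  replaces the spectral theorem.\<close>

lemma trace_mult_nonneg_supported:
  fixes A B :: "real^'n^'n"
  assumes "finite S" and A: "pos_semidef A" and "pos_semidef B"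
    and "\<And>i j. i \<notin> S \<Longrightarrow> B $ i $ j = 0"
  shows "0 \<le> trace (A ** B)"
  using assms(1,3,4)
proof (induction S arbitrary: B)
  case empty
  then have "B = 0"
    by (simp add: vec_eq_iff)
  then show ?case
    unfolding trace_matrix_mult by simp
next
  case (insert s S)
  \<comment> \<open>Pivot column and pivot entry of \<open>B\<close>, written through
    \<open>axis s 1\<close> so that the lemmas on quadratic forms apply.\<close>
  define v where "v = B *v axis s 1"
  define a where "a = axis s 1 \<bullet> (B *v axis s 1)"
  have v: "v $ i = B $ i $ s" for i
    by (simp add: v_def matrix_vector_mult_basis column_def)
  have a: "a = B $ s $ s"
    by (simp add: a_def inner_axis' flip: v_def) (simp add: v)
  have sym: "B $ i $ j = B $ j $ i" for i j
    using pos_semidef_symmetric [OF insert.prems(1)]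
    by (metis transpose_def vec_lambda_beta)
  have "a \<ge> 0"
    using insert.prems(1) by (simp add: pos_semidef_def a_def)
  then consider "a = 0" | "a > 0"
    by fastforce
  then show ?case
  proof cases
    case 1
    \<comment> \<open>A zero pivot kills column \<open>s\<close> and, by symmetry, row
      \<open>s\<close>, so the rows of \<open>B\<close> outside \<open>S\<close> already
      vanish.\<close>
    then have "v = 0"
      using pos_semidef_quadratic_zero [OF insert.prems(1)] by (simp add: a_def v_def)
    then have "B $ i $ j = 0" if "i \<notin> S" for i j
      using that insert.prems(2) [of i j] v [of j] sym [of s j] by (cases "i = s") auto
    then show ?thesis
      using insert.IH insert.prems(1) by blast
  next
    case 2
    define C where "C = B - (1 / a) *\<^sub>R outer_square v"
    have "pos_semidef C"
      using pos_semidef_eliminate [OF insert.prems(1)] 2 by (simp add: C_def a_def v_def)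
    \<comment> \<open>Row \<open>s\<close> cancels because \<open>v $ s = a\<close>; in the other
      rows outside \<open>S\<close> both \<open>B $ i $ j\<close> and \<open>v $ i\<close> are
      zero.\<close>
    moreover have "C $ i $ j = 0" if "i \<notin> S" for i j
      using that insert.prems(2) [of i] 2 sym [of s j]
      by (cases "i = s") (auto simp: C_def outer_square_def v a)
    ultimately have "0 \<le> trace (A ** C)"
      using insert.IH by blast
    moreover have "0 \<le> v \<bullet> (A *v v)"
      using A by (simp add: pos_semidef_def)
    moreover have "trace (A ** B) = trace (A ** C) + (1 / a) * (v \<bullet> (A *v v))"
    proof -
      have "A ** B = A ** C + (1 / a) *\<^sub>R (A ** outer_square v)"
        by (simp add: C_def matrix_diff_ldistrib bounded_bilinear.scaleR_right [OF bounded_bilinear_matrix_mult])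
      then show ?thesis
        by (simp add: trace_add trace_mult_outer_square
            linear_scale [OF bounded_linear.linear [OF bounded_linear_trace]])
    qed
    ultimately show ?thesis
      using 2 by simp
  qed
qed

lemma trace_mult_nonneg:
  assumes "pos_semidef A" and "pos_semidef B"
  shows "0 \<le> trace (A ** B)"
  using trace_mult_nonneg_supported [of UNIV] assms by simp

section \<open>Trace inequalities for powers of two matrices\<close>

text \<open>Factors \<open>N\<close> are exchanged for \<open>M\<close> one at a time. As
  \<open>N - M\<close> is symmetric, each exchange lowers the trace by that of a congruence of a
  power of \<open>M\<close> times a power of \<open>N\<close>, which is nonnegative.\<close>

lemma trace_diff_mult_powers_ge:
  fixes M N :: "real^'n^'n"
  assumes M: "pos_semidef M" and N: "pos_semidef N"
  shows "trace ((N - M) ** matrix_power M j ** matrix_power N i)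
    \<ge> trace ((N - M) ** matrix_power M (i + j))"
proof (induction i arbitrary: j)
  case (Suc i)
  let ?D = "N - M"
  have "pos_semidef (transpose ?D ** matrix_power M j ** ?D)"
    by (intro pos_semidef_congruence pos_semidef_matrix_power M)
  then have "0 \<le> trace (?D ** matrix_power M j ** ?D ** matrix_power N i)"
    using trace_mult_nonneg pos_semidef_matrix_power [OF N] pos_semidef_symmetric M N
    by (metis transpose_diff)
  also have "\<dots> = trace (?D ** matrix_power M j ** matrix_power N (Suc i))
      - trace (?D ** matrix_power M (Suc j) ** matrix_power N i)"
    unfolding matrix_power_Suc_right [of M j]
    by (simp add: matrix_diff_ldistrib matrix_diff_rdistrib matrix_mul_assoc trace_sub)
  finally show ?case
    using Suc.IH [of "Suc j"] by simp
qed simp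

text \<open>For \<open>j = 0\<close> this is the gradient inequality of the convex function
  \<open>N \<mapsto> trace (matrix_power N m)\<close>.\<close>

lemma trace_mult_powers_ge:
  fixes M N :: "real^'n^'n"
  assumes M: "pos_semidef M" and N: "pos_semidef N"
  shows "trace (matrix_power M j ** matrix_power N m)
    \<ge> trace (matrix_power M (m + j)) + real m * trace ((N - M) ** matrix_power M (m + j - 1))"
\<comment> \<open>\<open>j\<close> varies because each step turns one \<open>N\<close> into an
  \<open>M\<close>. At \<open>m = 0\<close> the exponent \<open>m + j - 1\<close> may be truncated,
  but its coefficient is zero.\<close>
proof (induction m arbitrary: j)
  case (Suc m)
  let ?D = "N - M"
  \<comment> \<open>Cyclicity brings one \<open>N\<close> to the front, where it splits as
    \<open>M + ?D\<close>.\<close>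
  have "trace (matrix_power M j ** matrix_power N (Suc m))
      = trace (N ** (matrix_power M j ** matrix_power N m))"
    unfolding trace_mul_sym [of N] matrix_power_Suc_right by (simp only: matrix_mul_assoc)
  also have "\<dots> = trace (matrix_power M (Suc j) ** matrix_power N m)
      + trace (?D ** matrix_power M j ** matrix_power N m)"
    by (simp add: matrix_diff_rdistrib trace_sub matrix_mul_assoc)
  also have "\<dots> \<ge> trace (matrix_power M (m + Suc j))
      + real m * trace (?D ** matrix_power M (m + Suc j - 1))
      + trace (?D ** matrix_power M (m + j))"
    using Suc.IH [of "Suc j"] trace_diff_mult_powers_ge [OF M N, of m j] by linarith
  finally show ?case
    by (simp add: algebra_simps)
qed simp

section \<open>Derivatives of matrix powers and the matrix gradient\<close>

text \<open>\<open>g x\<close> and \<open>g' h\<close> need not commute, but only traces against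
  powers of \<open>g x\<close> matter, and there cyclicity merges all terms. The exponent
  \<open>j\<close> is free because the induction step moves a factor \<open>g x\<close> into
  it.\<close>

lemma has_derivative_matrix_power:
  fixes g :: "'a::real_normed_vector \<Rightarrow> real^'k^'k"
  assumes g: "(g has_derivative g') (at x)"
  shows "\<exists>D. ((\<lambda>x. matrix_power (g x) m) has_derivative D) (at x) \<and>
    (\<forall>h j. trace (D h ** matrix_power (g x) j)
      = real m * trace (g' h ** matrix_power (g x) (m + j - 1)))"
proof (induction m)
  case 0
  have "((\<lambda>x. matrix_power (g x) 0) has_derivative (\<lambda>h. 0)) (at x)"
    by simp
  then show ?case
    by (intro exI [of _ "\<lambda>h. 0"]) (simp add: trace_def)
next
  case (Suc m)
  then obtain D where D: "((\<lambda>x. matrix_power (g x) m) has_derivative D) (at x)"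
    and tr: "\<And>h j. trace (D h ** matrix_power (g x) j)
      = real m * trace (g' h ** matrix_power (g x) (m + j - 1))"
    by blast
  have "((\<lambda>x. matrix_power (g x) (Suc m)) has_derivative
      (\<lambda>h. g x ** D h + g' h ** matrix_power (g x) m)) (at x)"
    using bounded_bilinear.FDERIV [OF bounded_bilinear_matrix_mult g D] by simp
  moreover have "trace ((g x ** D h + g' h ** matrix_power (g x) m) ** matrix_power (g x) j)
      = real (Suc m) * trace (g' h ** matrix_power (g x) (Suc m + j - 1))" for h j
  proof -
    have "trace (g x ** (D h ** matrix_power (g x) j)) = trace (D h ** matrix_power (g x) (Suc j))"
      unfolding trace_mul_sym [of "g x"] matrix_power_Suc_right by (simp only: matrix_mul_assoc)
    then show ?thesis
      using tr [of h "Suc j"]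
      by (simp add: matrix_add_rdistrib trace_add algebra_simps
          flip: matrix_mul_assoc matrix_power_add)
  qed
  ultimately show ?case
    by blast
qed

text \<open>The trace is the entrywise inner product of \<open>H\<close> with the gradient, a sum of
  partial derivatives weighted by the entries of \<open>H\<close>; linearity of \<open>F\<close>
  reassembles \<open>H\<close> from the matrix units \<open>E i j\<close>.\<close>

lemma trace_matrix_gradient:
  fixes f :: "real^'k^'n \<Rightarrow> real"
  assumes f: "(f has_derivative F) (at P)"
  shows "trace (transpose H ** matrix_gradient f P) = F H"
proof -
  define E :: "'n \<Rightarrow> 'k \<Rightarrow> real^'k^'n" where "E i j = (\<chi> a b. if i = a \<and> j = b then 1 else 0)" for i j
  have lin: "linear F"
    using f by (rule has_derivative_linear)
  have upd: "update_entry P i j t = P + (t - P $ i $ j) *\<^sub>R E i j" for i j t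
    by (auto simp: update_entry_def E_def vec_eq_iff)
  have "matrix_gradient f P $ i $ j = F (E i j)" for i j
  proof -
    have "((\<lambda>t. P + (t - P $ i $ j) *\<^sub>R E i j) has_derivative (\<lambda>h. h *\<^sub>R E i j))
        (at (P $ i $ j))"
      by (auto intro!: derivative_eq_intros)
    \<comment> \<open>The base point is written as the value of the line at
      \<open>t = P $ i $ j\<close>, the form the chain rule expects.\<close>
    moreover have "(f has_derivative F) (at (P + (P $ i $ j - P $ i $ j) *\<^sub>R E i j))"
      using f by simp
    ultimately have "((\<lambda>t. f (update_entry P i j t)) has_derivative (\<lambda>h. F (h *\<^sub>R E i j)))
        (at (P $ i $ j))"
      unfolding upd by (rule has_derivative_compose)
    then have "DERIV (\<lambda>t. f (update_entry P i j t)) (P $ i $ j) :> F (E i j)"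
      by (simp add: has_field_derivative_def linear_scale [OF lin] mult_commute_abs)
    then show ?thesis
      by (simp add: matrix_gradient_def DERIV_imp_deriv)
  qed
  then have "trace (transpose H ** matrix_gradient f P)
      = F (\<Sum>i\<in>UNIV. \<Sum>j\<in>UNIV. H $ i $ j *\<^sub>R E i j)"
    by (simp add: trace_transpose_mult linear_sum [OF lin] linear_scale [OF lin])
  also have "(\<Sum>i\<in>UNIV. \<Sum>j\<in>UNIV. H $ i $ j *\<^sub>R E i j) = H"
  proof -
    have "(\<Sum>j\<in>UNIV. H $ i $ j * E i j $ a $ b) = (if i = a then H $ a $ b else 0)" for i a b
      by (simp add: E_def if_distrib [of "(*) _"] cong: if_cong)
    then show ?thesis
      by (simp add: vec_eq_iff)
  qed
  finally show ?thesis .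
qed

lemma has_derivative_trace_power:
  fixes A :: "real^'n^'n" and P :: "real^'k^'n"
  assumes "m \<ge> 1"
  shows "(trace_power A m has_derivative (\<lambda>H. real m *
    trace ((transpose P ** A ** H + transpose H ** A ** P)
      ** matrix_power (transpose P ** A ** P) (m - 1)))) (at P)"
proof -
  note mult = bounded_bilinear.FDERIV [OF bounded_bilinear_matrix_mult]
  have "((\<lambda>P. transpose P ** A ** P) has_derivative
      (\<lambda>H. transpose P ** A ** H + (transpose P ** 0 + transpose H ** A) ** P)) (at P)"
    by (intro mult bounded_linear_imp_has_derivative bounded_linear_transpose
        has_derivative_const has_derivative_ident)
  then have "((\<lambda>P. transpose P ** A ** P) has_derivative
      (\<lambda>H. transpose P ** A ** H + transpose H ** A ** P)) (at P)"
    by (simp add: bounded_bilinear.zero_right [OF bounded_bilinear_matrix_mult])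
  from has_derivative_matrix_power [OF this, of m]
  obtain D where D: "((\<lambda>P. matrix_power (transpose P ** A ** P) m) has_derivative D) (at P)"
    and tr: "\<And>H j. trace (D H ** matrix_power (transpose P ** A ** P) j) = real m *
      trace ((transpose P ** A ** H + transpose H ** A ** P)
        ** matrix_power (transpose P ** A ** P) (m + j - 1))"
    by blast
  have "((\<lambda>P. trace (matrix_power (transpose P ** A ** P) m)) has_derivative
      (\<lambda>H. trace (D H))) (at P)"
    by (rule bounded_linear.has_derivative [OF bounded_linear_trace D])
  \<comment> \<open>Exponent \<open>j = 0\<close> turns the paired trace into
    \<open>trace (D H)\<close>.\<close>
  then show ?thesis
    using tr [of _ 0] by (simp add: trace_power_def [abs_def])
qed

section \<open>The gradient of the trace power and its two estimates\<close>

lemma trace_gradient_trace_power: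
  fixes A :: "real^'n^'n" and P H :: "real^'k^'n"
  assumes "m \<ge> 1"
  shows "trace (transpose H ** matrix_gradient (trace_power A m) P) = real m *
    trace ((transpose P ** A ** H + transpose H ** A ** P)
      ** matrix_power (transpose P ** A ** P) (m - 1))"
  by (rule trace_matrix_gradient [OF has_derivative_trace_power [OF assms]])

lemma trace_gradient_trace_power_self:
  fixes A :: "real^'n^'n" and P :: "real^'k^'n"
  assumes "m \<ge> 1"
  shows "trace (transpose P ** matrix_gradient (trace_power A m) P)
    = 2 * real m * trace_power A m P"
proof -
  \<comment> \<open>Removes the truncated subtraction, so that the power \<open>m - 1\<close>
    absorbs one more factor to become the power \<open>m\<close>.\<close>
  obtain l where "m = Suc l"
    using assms by (cases m) auto
  then show ?thesis
    unfolding trace_gradient_trace_power [OF assms] matrix_add_rdistrib trace_add trace_power_def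
    by simp
qed

lemma trace_gradient_trace_power_le:
  fixes A :: "real^'n^'n" and P H :: "real^'k^'n"
  assumes m: "m \<ge> 1" and A: "pos_semidef A"
  shows "trace (transpose H ** matrix_gradient (trace_power A m) P)
    \<le> trace_power A m H + (2 * real m - 1) * trace_power A m P"
proof -
  define M where "M = transpose P ** A ** P"
  define N where "N = transpose H ** A ** H"
  define R where "R = transpose (H - P) ** A ** (H - P)"
  have psd: "pos_semidef M" "pos_semidef N" "pos_semidef R"
    unfolding M_def N_def R_def by (intro pos_semidef_congruence A)+
  \<comment> \<open>Split by use: \<open>2 *\<^sub>R M\<close> gives \<open>2 * m\<close> copies of
    the trace for \<open>P\<close>, \<open>N - M\<close> enters the gradient inequality, and
    \<open>R\<close> contributes a nonnegative trace that is dropped.\<close>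
  have "transpose P ** A ** H + transpose H ** A ** P = 2 *\<^sub>R M + (N - M) - R"
    by (simp add: M_def N_def R_def transpose_diff matrix_diff_ldistrib matrix_diff_rdistrib
        scaleR_2)
  then have grad: "trace (transpose H ** matrix_gradient (trace_power A m) P)
      = real m * trace ((2 *\<^sub>R M + (N - M) - R) ** matrix_power M (m - 1))"
    by (simp add: trace_gradient_trace_power [OF m] M_def)
  have "trace (M ** matrix_power M (m - 1)) = trace (matrix_power M m)"
    using m by (cases m) auto
  then have expand: "trace ((2 *\<^sub>R M + (N - M) - R) ** matrix_power M (m - 1))
      = 2 * trace (matrix_power M m) + trace ((N - M) ** matrix_power M (m - 1))
        - trace (R ** matrix_power M (m - 1))"
    by (simp add: matrix_diff_rdistrib matrix_add_rdistrib trace_add trace_sub scaleR_2)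
  have "0 \<le> real m * trace (R ** matrix_power M (m - 1))"
    by (simp add: trace_mult_nonneg psd pos_semidef_matrix_power)
  moreover have "trace (matrix_power N m)
      \<ge> trace (matrix_power M m) + real m * trace ((N - M) ** matrix_power M (m - 1))"
    using trace_mult_powers_ge [OF psd(1,2), of m 0] by simp
  \<comment> \<open>The gradient inequality uses up one copy of
    \<open>trace (matrix_power M m)\<close>, whence the coefficient
    \<open>2 * real m - 1\<close>.\<close>
  ultimately have "real m * trace ((2 *\<^sub>R M + (N - M) - R) ** matrix_power M (m - 1))
      \<le> trace (matrix_power N m) + (2 * real m - 1) * trace (matrix_power M m)"
    unfolding expand by (simp add: algebra_simps)
  then show ?thesis
    by (simp add: grad trace_power_def M_def N_def)
qed

theorem theorem4p4:
  fixes A :: "real^'n^'n" and m :: nat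
  assumes "CARD('k::finite) \<le> CARD('n)"
    and "symmetric_matrix A"
    and "m \<ge> 1"
  shows "(\<forall>P :: real^'k^'n.
            trace (transpose P ** matrix_gradient (trace_power A m) P)
              = 2 * real m * trace_power A m P)
       \<and> (pos_semidef A \<longrightarrow>
            (\<forall>P Ph :: real^'k^'n.
               trace (transpose Ph ** matrix_gradient (trace_power A m) P)
                 \<le> trace_power A m Ph + (2 * real m - 1) * trace_power A m P))
       \<and> (pos_semidef A \<longrightarrow>
            npdo_cond1 (trace_power A m) (stiefel :: (real^'k^'n) set) (1 + (2 * real m - 1))
          \<and> npdo_cond2 (trace_power A m) (stiefel :: (real^'k^'n) set) 1 (2 * real m - 1)
          \<and> (\<forall>P \<in> stiefel. \<forall>Ph \<in> (stiefel :: (real^'k^'n) set).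
               npdo_witness (trace_power A m) stiefel 1 (2 * real m - 1) P Ph (mat 1)
             \<and> Ph ** mat 1 = Ph)
          \<and> npdo_atomic (trace_power A m :: real^'k^'n \<Rightarrow> real))"
proof -
  let ?f = "trace_power A m :: real^'k^'n \<Rightarrow> real"
  have cond1: "npdo_cond1 ?f stiefel (1 + (2 * real m - 1))"
    by (simp add: npdo_cond1_def trace_gradient_trace_power_self [OF assms(3)])
  \<comment> \<open>For the identity, \<open>Ph ** mat 1\<close> is \<open>Ph\<close>, so the
    condition is the inequality of (b).\<close>
  have witness: "npdo_witness ?f stiefel 1 (2 * real m - 1) P Ph (mat 1)"
    if "pos_semidef A" and "Ph \<in> stiefel" for P Ph :: "real^'k^'n"
    using that trace_gradient_trace_power_le [OF assms(3) that(1)]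
    by (simp add: npdo_witness_def stiefel_def)
  have cond2: "npdo_cond2 ?f stiefel 1 (2 * real m - 1)" if "pos_semidef A"
    using witness [OF that] by (auto simp: npdo_cond2_def)
  \<comment> \<open>The derivative exists at every matrix, so any radius would do.\<close>
  have "?f differentiable_on stiefel_nbhd 1"
    using has_derivative_trace_power [OF assms(3)]
    by (auto simp: differentiable_on_def differentiable_def intro: has_derivative_at_withinI)
  \<comment> \<open>\<open>m \<ge> 1\<close> makes the constant \<open>2 * real m - 1\<close>
    nonnegative.\<close>
  then have "npdo_atomic ?f" if "pos_semidef A"
    unfolding npdo_atomic_def
    using cond1 cond2 [OF that] assms(3)
    by (intro conjI exI [of _ 1] exI [of _ "2 * real m - 1"] exI [of _ stiefel]) auto
  moreover have "trace (transpose P ** matrix_gradient ?f P) = 2 * real m * ?f P"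
    for P :: "real^'k^'n"
    by (rule trace_gradient_trace_power_self [OF assms(3)])
  moreover have "trace (transpose Ph ** matrix_gradient ?f P) \<le> ?f Ph + (2 * real m - 1) * ?f P"
    if "pos_semidef A" for P Ph :: "real^'k^'n"
    by (rule trace_gradient_trace_power_le [OF assms(3) that])
  ultimately show ?thesis
    using cond1 cond2 witness by simp
qed

end
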